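(* For every simple stochastic game, the following two algorithms both terminate (for every choice of the initial strategy and every choice of minimising, respectively maximising, successors in the switches) and return the least fixpoint $\mu\mathcal{V}$ of the value function $\mathcal{V}$. Strategy iteration from above: 1. Choose a Min-strategy $\tau^{(0)}$; $i:=0$. 2. $a^{(i)}:=\mu\mathcal{V}_{\tau^{(i)}}$. 3. $\tau^{(i+1)}:=\mathrm{sw}_{\min}(\tau^{(i)},a^{(i)})$. 4. If $\tau^{(i+1)}\neq\tau^{(i)}$ then $i:=i+1$ and go to 2. 5. Compute $V'=\nu\mathcal{V}_{\#}^{a}$, where $a=a^{(i)}$. 6. If $V'=\emptyset$ then stop and return $a^{(i)}$. Otherwise $a^{(i+1)}:=a-(\iota_{\mathcal{V}}^{a}(V'))_{V'}$, $\tau^{(i+2)}:=\mathrm{sw}_{\min}(\tau^{(i)},a^{(i+1)})$, $i:=i+2$, go to 2. Strategy iteration from below: 1. Choose a Max-strategy $\sigma^{(0)}$; $i:=0$. 2. $a^{(i)}:=\mu\mathcal{V}_{\sigma^{(i)}}$. 3. $\sigma^{(i+1)}:=\mathrm{sw}_{\max}(\sigma^{(i)},a^{(i)})$. 4. If $\sigma^{(i+1)}\neq\sigma^{(i)}$ then $i:=i+1$ and go to 2; otherwise stop and return $a^{(i)}$.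
   Context: Simple stochastic game: a finite set $V$ of nodes partitioned into $\mathit{MIN},\mathit{MAX},\mathit{AV},\mathit{SINK}$, with successor functions $\eta_{\min}:\mathit{MIN}\to\mathbf{2}^V$, $\eta_{\max}:\mathit{MAX}\to\mathbf{2}^V$ (successor sets nonempty), $\eta_{\mathrm{av}}:\mathit{AV}\to D$ with $D\subseteq\mathcal{D}(V)$ a finite set of probability distributions on $V$, and $w:\mathit{SINK}\to[0,1]$. The game is not assumed to be stopping. The value function $\mathcal{V}:[0,1]^V\to[0,1]^V$ is: $\mathcal{V}(a)(v)=\min_{v'\in\eta_{\min}(v)}a(v')$ for $v\in\mathit{MIN}$; $\max_{v'\in\eta_{\max}(v)}a(v')$ for $v\in\mathit{MAX}$; $\sum_{v'\in V}\eta_{\mathrm{av}}(v)(v')\cdot a(v')$ for $v\in\mathit{AV}$; $w(v)$ for $v\in\mathit{SINK}$. $\mu$ and $\nu$ denote least and greatest fixpoints of monotone functions on complete lattices ($[0,1]^V$ with pointwise order, or powersets with inclusion). Strategies: a Min-strategy is $\tau:\mathit{MIN}\to V$ with $\tau(v)\in\eta_{\min}(v)$; a Max-strategy is $\sigma:\mathit{MAX}\to V$ with $\sigma(v)\in\eta_{\max}(v)$. $\mathcal{V}_\tau$ is defined as $\mathcal{V}$ except $\mathcal{V}_\tau(a)(v)=a(\tau(v))$ for $v\in\mathit{MIN}$; $\mathcal{V}_\sigma$ is defined as $\mathcal{V}$ except $\mathcal{V}_\sigma(a)(v)=a(\sigma(v))$ for $v\in\mathit{MAX}$. Switches: given a Min-strategy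 $\tau$ and $a\in[0,1]^V$, a switch node is $v\in\mathit{MIN}$ with $\min_{v'\in\eta_{\min}(v)}a(v')<a(\tau(v))$. $\tau'=\mathrm{sw}_{\min}(\tau,a)$ is a Min-strategy with $\tau'(v)\in\arg\min_{v'\in\eta_{\min}(v)}a(v')$ (one minimiser chosen arbitrarily) at switch nodes and $\tau'(v)=\tau(v)$ elsewhere. $\mathrm{sw}_{\max}(\sigma,a)$ is analogous: at nodes $v\in\mathit{MAX}$ with $\max_{v'\in\eta_{\max}(v)}a(v')>a(\sigma(v))$ it picks a maximising successor, and agrees with $\sigma$ elsewhere. Approximation: write $x\ominus y=\max\{0,x-y\}$ (pointwise on functions). For $V'\subseteq V$ and $\theta\in[0,1]$, $\theta_{V'}$ is the function equal to $\theta$ on $V'$ and $0$ elsewhere. For $a\in[0,1]^V$ let $[V]^a=\{v\in V\mid a(v)\neq0\}$ and $\delta^a=\min\{a(v)\mid v\in[V]^a\}$ ($\min\emptyset=1$). For $\theta\in[0,1]$, $V'\subseteq[V]^a$ let $\mathcal{V}^{a,\theta}_{\#}(V')=\{v\in[V]^{\mathcal{V}(a)}\mid\mathcal{V}(a)(v)\ominus\mathcal{V}(a\ominus\theta_{V'})(v)\geq\theta\}$; for $v\in[V]^{\mathcal{V}(a)}$ let $\iota^a_{\mathcal{V}}(V',v)=\max\{\theta\in[0,1]\mid v\in\mathcal{V}^{a,\theta}_{\#}(V')\}$; let $\iota^a_{\mathcal{V}}=\min\big(\{\iota^a_{\mathcal{V}}(V',v)\mid V'\subseteq[V]^a,v\in[V]^{\mathcal{V}(a)},\iota^a_{\mathcal{V}}(V',v)\neq0\}\cup\{\delta^a\}\big)$.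 Then $\mathcal{V}^a_{\#}=\mathcal{V}^{a,\iota^a_{\mathcal{V}}}_{\#}:\mathbf{2}^{[V]^a}\to\mathbf{2}^{[V]^{\mathcal{V}(a)}}$ (an endofunction when $\mathcal{V}(a)=a$), and for $V'\subseteq[V]^a$, $\iota^a_{\mathcal{V}}(V')=\min\{\iota^a_{\mathcal{V}}(V',v)\mid v\in V'\}$. *)

theory Defs
  imports "HOL-Probability.Probability_Mass_Function"
begin

text \<open>
  The node set \<open>V\<close> is the finite type \<open>'v\<close>. The values of \<open>min_succ\<close>, \<open>max_succ\<close>, \<open>av_dist\<close>,
  \<open>sink_val\<close> outside \<open>min_nodes\<close>, \<open>max_nodes\<close>, \<open>av_nodes\<close>, \<open>sink_nodes\<close>, respectively, are irrelevant.
\<close>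

record 'v ssg =
  min_nodes :: "'v set"
  max_nodes :: "'v set"
  av_nodes :: "'v set"
  sink_nodes :: "'v set"
  min_succ :: "'v \<Rightarrow> 'v set"
  max_succ :: "'v \<Rightarrow> 'v set"
  dists :: "'v pmf set"
  av_dist :: "'v \<Rightarrow> 'v pmf"
  sink_val :: "'v \<Rightarrow> real"

definition simple_stochastic_game :: "('v::finite) ssg \<Rightarrow> bool" where
  "simple_stochastic_game G \<longleftrightarrow>
     min_nodes G \<union> max_nodes G \<union> av_nodes G \<union> sink_nodes G = UNIV \<and>
     min_nodes G \<inter> max_nodes G = {} \<and> min_nodes G \<inter> av_nodes G = {} \<and>
     min_nodes G \<inter> sink_nodes G = {} \<and> max_nodes G \<inter> av_nodes G = {} \<and>
     max_nodes G \<inter> sink_nodes G = {} \<and> av_nodes G \<inter> sink_nodes G = {} \<and>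
     (\<forall>v\<in>min_nodes G. min_succ G v \<noteq> {}) \<and>
     (\<forall>v\<in>max_nodes G. max_succ G v \<noteq> {}) \<and>
     finite (dists G) \<and> (\<forall>v\<in>av_nodes G. av_dist G v \<in> dists G) \<and>
     (\<forall>v\<in>sink_nodes G. sink_val G v \<in> {0..1})"

type_synonym 'v valuation = "'v \<Rightarrow> real"

definition valuations :: "('v valuation) set" where
  "valuations = {a. \<forall>v. a v \<in> {0..1}}"

definition value_fun :: "('v::finite) ssg \<Rightarrow> 'v valuation \<Rightarrow> 'v valuation" where
  "value_fun G a v =
     (if v \<in> min_nodes G then Min (a ` min_succ G v)
      else if v \<in> max_nodes G then Max (a ` max_succ G v)
      else if v \<in> av_nodes G then (\<Sum>v'\<in>UNIV. pmf (av_dist G v) v' * a v')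
      else sink_val G v)"

text \<open>
  Least fixpoint in the complete lattice \<open>[0,1]\<^sup>V\<close> and greatest fixpoint in the powerset of \<open>A\<close>.
  By Knaster-Tarski both descriptions denote whenever the function is a monotone endofunction.
\<close>

definition val_lfp :: "('v valuation \<Rightarrow> 'v valuation) \<Rightarrow> 'v valuation" where
  "val_lfp f = (LEAST a. a \<in> valuations \<and> f a = a)"

definition pow_gfp :: "'v set \<Rightarrow> ('v set \<Rightarrow> 'v set) \<Rightarrow> 'v set" where
  "pow_gfp A f = (GREATEST X. X \<subseteq> A \<and> f X = X)"

text \<open>
  Strategies are extensional functions (\<open>undefined\<close> outside the nodes of the player), so that
  equality of strategies is equality on the nodes of the player.
\<close>

definition min_strategies :: "'v ssg \<Rightarrow> ('v \<Rightarrow> 'v) set" where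
  "min_strategies G = Pi\<^sub>E (min_nodes G) (min_succ G)"

definition max_strategies :: "'v ssg \<Rightarrow> ('v \<Rightarrow> 'v) set" where
  "max_strategies G = Pi\<^sub>E (max_nodes G) (max_succ G)"

definition value_fun_min :: "('v::finite) ssg \<Rightarrow> ('v \<Rightarrow> 'v) \<Rightarrow> 'v valuation \<Rightarrow> 'v valuation" where
  "value_fun_min G \<tau> a v = (if v \<in> min_nodes G then a (\<tau> v) else value_fun G a v)"

definition value_fun_max :: "('v::finite) ssg \<Rightarrow> ('v \<Rightarrow> 'v) \<Rightarrow> 'v valuation \<Rightarrow> 'v valuation" where
  "value_fun_max G \<sigma> a v = (if v \<in> max_nodes G then a (\<sigma> v) else value_fun G a v)"

text \<open>
  Switching is nondeterministic: \<open>sw_min G \<tau> a\<close> and \<open>sw_max G \<sigma> a\<close> are the sets of all possible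
  results, one for each choice of optimal successors at the switch nodes.
\<close>

definition sw_min :: "'v ssg \<Rightarrow> ('v \<Rightarrow> 'v) \<Rightarrow> 'v valuation \<Rightarrow> ('v \<Rightarrow> 'v) set" where
  "sw_min G \<tau> a = {\<tau>' \<in> min_strategies G. \<forall>v\<in>min_nodes G.
     if Min (a ` min_succ G v) < a (\<tau> v) then is_arg_min a (\<lambda>v'. v' \<in> min_succ G v) (\<tau>' v)
     else \<tau>' v = \<tau> v}"

definition sw_max :: "'v ssg \<Rightarrow> ('v \<Rightarrow> 'v) \<Rightarrow> 'v valuation \<Rightarrow> ('v \<Rightarrow> 'v) set" where
  "sw_max G \<sigma> a = {\<sigma>' \<in> max_strategies G. \<forall>v\<in>max_nodes G.
     if Max (a ` max_succ G v) > a (\<sigma> v) then is_arg_max a (\<lambda>v'. v' \<in> max_succ G v) (\<sigma>' v)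
     else \<sigma>' v = \<sigma> v}"

definition on_set :: "real \<Rightarrow> 'v set \<Rightarrow> 'v valuation" where
  "on_set \<theta> V' = (\<lambda>v. if v \<in> V' then \<theta> else 0)"

definition tminus :: "real \<Rightarrow> real \<Rightarrow> real" (infixl \<open>\<ominus>\<close> 65) where
  "x \<ominus> y = max 0 (x - y)"

definition support :: "'v valuation \<Rightarrow> 'v set" where
  "support a = {v. a v \<noteq> 0}"

text \<open>Minimum of a finite subset of \<open>[0,1]\<close>, with the convention \<open>min {} = 1\<close>.\<close>

definition unit_min :: "real set \<Rightarrow> real" where
  "unit_min S = (if S = {} then 1 else Min S)"

definition delta :: "'v valuation \<Rightarrow> real" where
  "delta a = unit_min (a ` support a)"

text \<open>
  In what follows \<open>f\<close> is the value function \<open>\<V>\<close>: \<open>approx_at f a \<theta>\<close> is \<open>\<V>\<close> with superscript \<open>a,\<theta>\<close>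
  and subscript \<open>#\<close>; \<open>iota_node\<close>, \<open>iota\<close>, \<open>iota_set\<close> are \<open>\<iota>(V',v)\<close>, \<open>\<iota>\<close>, \<open>\<iota>(V')\<close> with superscript
  \<open>a\<close> and subscript \<open>\<V>\<close>. The maximum in \<open>iota_node\<close> ranges over an infinite set of reals, whence
  \<open>Greatest\<close> instead of \<open>Max\<close>.
\<close>

definition approx_at ::
  "('v valuation \<Rightarrow> 'v valuation) \<Rightarrow> 'v valuation \<Rightarrow> real \<Rightarrow> 'v set \<Rightarrow> 'v set" where
  "approx_at f a \<theta> V' =
     {v \<in> support (f a). f a v \<ominus> f (\<lambda>u. a u \<ominus> on_set \<theta> V' u) v \<ge> \<theta>}"

definition iota_node ::
  "('v valuation \<Rightarrow> 'v valuation) \<Rightarrow> 'v valuation \<Rightarrow> 'v set \<Rightarrow> 'v \<Rightarrow> real" where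
  "iota_node f a V' v = (GREATEST \<theta>. \<theta> \<in> {0..1} \<and> v \<in> approx_at f a \<theta> V')"

definition iota :: "('v valuation \<Rightarrow> 'v valuation) \<Rightarrow> 'v valuation \<Rightarrow> real" where
  "iota f a = Min ({iota_node f a V' v | V' v.
     V' \<subseteq> support a \<and> v \<in> support (f a) \<and> iota_node f a V' v \<noteq> 0} \<union> {delta a})"

definition approx ::
  "('v valuation \<Rightarrow> 'v valuation) \<Rightarrow> 'v valuation \<Rightarrow> 'v set \<Rightarrow> 'v set" where
  "approx f a = approx_at f a (iota f a)"

definition iota_set ::
  "('v valuation \<Rightarrow> 'v valuation) \<Rightarrow> 'v valuation \<Rightarrow> 'v set \<Rightarrow> real" where
  "iota_set f a V' = unit_min (iota_node f a V' ` V')"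

text \<open>
  Configurations of the two algorithms: \<open>Iterate \<tau>\<close> is control at step 2 with current strategy
  \<open>\<tau>\<close>, \<open>Return a\<close> is having stopped with result \<open>a\<close>. A transition is one pass through the loop body.
  The counter \<open>i\<close> only labels the successive iterates and is not part of the configuration.
\<close>

datatype 'v config = Iterate "'v \<Rightarrow> 'v" | Return "'v valuation"

inductive above_step :: "('v::finite) ssg \<Rightarrow> 'v config \<Rightarrow> 'v config \<Rightarrow> bool" for G where
  switch:
    "above_step G (Iterate \<tau>) (Iterate \<tau>')"
    if "a = val_lfp (value_fun_min G \<tau>)" "\<tau>' \<in> sw_min G \<tau> a" "\<tau>' \<noteq> \<tau>"
| stop:
    "above_step G (Iterate \<tau>) (Return a)"
    if "a = val_lfp (value_fun_min G \<tau>)" "\<tau>' \<in> sw_min G \<tau> a" "\<tau>' = \<tau>"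
       "V' = pow_gfp (support a) (approx (value_fun G) a)" "V' = {}"
| decrease:
    "above_step G (Iterate \<tau>) (Iterate \<tau>'')"
    if "a = val_lfp (value_fun_min G \<tau>)" "\<tau>' \<in> sw_min G \<tau> a" "\<tau>' = \<tau>"
       "V' = pow_gfp (support a) (approx (value_fun G) a)" "V' \<noteq> {}"
       "a' = (\<lambda>v. a v - on_set (iota_set (value_fun G) a V') V' v)" "\<tau>'' \<in> sw_min G \<tau> a'"

inductive below_step :: "('v::finite) ssg \<Rightarrow> 'v config \<Rightarrow> 'v config \<Rightarrow> bool" for G where
  switch:
    "below_step G (Iterate \<sigma>) (Iterate \<sigma>')"
    if "a = val_lfp (value_fun_max G \<sigma>)" "\<sigma>' \<in> sw_max G \<sigma> a" "\<sigma>' \<noteq> \<sigma>"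
| stop:
    "below_step G (Iterate \<sigma>) (Return a)"
    if "a = val_lfp (value_fun_max G \<sigma>)" "\<sigma>' \<in> sw_max G \<sigma> a" "\<sigma>' = \<sigma>"

definition terminates :: "('c \<Rightarrow> 'c \<Rightarrow> bool) \<Rightarrow> 'c \<Rightarrow> bool" where
  "terminates step c \<longleftrightarrow> \<not> (\<exists>s. s (0::nat) = c \<and> (\<forall>i. step (s i) (s (Suc i))))"

text \<open>
  Quantifies over every configuration from which no transition is possible, so it also rules out
  runs that get stuck before returning.
\<close>

definition only_returns ::
  "('v config \<Rightarrow> 'v config \<Rightarrow> bool) \<Rightarrow> 'v config \<Rightarrow> 'v valuation \<Rightarrow> bool" where
  "only_returns step c a \<longleftrightarrow>
     (\<forall>c'. step\<^sup>*\<^sup>* c c' \<and> \<not> (\<exists>c''. step c' c'') \<longrightarrow> c' = Return a)"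

end

(* Along either algorithm the valuations mu V_tau (mu V_sigma) change strictly monotonically, and
   there are only finitely many strategies. From above, a switch makes a = mu V_tau a prefixpoint
   but not a fixpoint of the new V_tau', and a decrease along a nonempty gfp of the approximation
   gives a strictly smaller prefixpoint. Correctness of the answer from above and monotonicity from
   below rest on one observation: if b is a fixpoint and a - b attains its maximum theta > 0 exactly
   on X, then every node of X owes its excess to successors in X, so lowering a on X by a small
   amount lowers the value function on X by at least as much. From above, with b = mu V, this makes
   X a postfixpoint of the approximation, so an empty gfp forces a = mu V. From below, with
   b = mu V_sigma' for the switched strategy sigma', no node of X was switched, so lowering
   a = mu V_sigma on X would contradict its minimality; hence a <= b. *)

theory Submission imports Defs begin

subsection \<open>The value function\<close>

text \<open>Fixing a strategy leaves each Min node a single successor, so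
  \<open>value_fun_min G \<tau>\<close> is itself the value function of a game and every fact about
  \<open>value_fun\<close> transfers to it.\<close>

lemma value_fun_restrict_min: "value_fun (G\<lparr>min_succ := \<lambda>v. {\<tau> v}\<rparr>) = value_fun_min G \<tau>"
  by (intro ext) (simp add: value_fun_def value_fun_min_def)

lemma max_node_not_min_node:
  assumes "simple_stochastic_game G" "v \<in> max_nodes G"
  shows "v \<notin> min_nodes G"
proof -
  have "min_nodes G \<inter> max_nodes G = {}" using assms(1) by (simp add: simple_stochastic_game_def)
  then show ?thesis using assms(2) by blast
qed

text \<open>Disjointness of the node classes enters here: \<open>value_fun\<close> tests
  \<open>min_nodes\<close> first, whereas \<open>value_fun_max\<close> tests
  \<open>max_nodes\<close> first.\<close>

lemma value_fun_restrict_max: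
  assumes "simple_stochastic_game G"
  shows "value_fun (G\<lparr>max_succ := \<lambda>v. {\<sigma> v}\<rparr>) = value_fun_max G \<sigma>"
  using max_node_not_min_node[OF assms]
  by (intro ext) (simp add: value_fun_def value_fun_max_def)

lemma simple_stochastic_game_restrict_min:
  "simple_stochastic_game G \<Longrightarrow> simple_stochastic_game (G\<lparr>min_succ := \<lambda>v. {\<tau> v}\<rparr>)"
  by (simp add: simple_stochastic_game_def)

lemma simple_stochastic_game_restrict_max:
  "simple_stochastic_game G \<Longrightarrow> simple_stochastic_game (G\<lparr>max_succ := \<lambda>v. {\<sigma> v}\<rparr>)"
  by (simp add: simple_stochastic_game_def)

text \<open>Each case leaves \<open>a\<close> universally quantified in the equation for
  \<open>value_fun\<close>, so that one distinction on \<open>v\<close> evaluates several valuations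
  at once.\<close>

lemma node_cases [consumes 1, case_names min max av sink]:
  fixes G :: "('v::finite) ssg"
  assumes "simple_stochastic_game G"
  obtains "v \<in> min_nodes G" "min_succ G v \<noteq> {}" "\<And>a. value_fun G a v = Min (a ` min_succ G v)"
  | "v \<in> max_nodes G" "max_succ G v \<noteq> {}" "\<And>a. value_fun G a v = Max (a ` max_succ G v)"
  | "v \<in> av_nodes G" "\<And>a. value_fun G a v = (\<Sum>u\<in>UNIV. pmf (av_dist G v) u * a u)"
  | "v \<in> sink_nodes G" "sink_val G v \<in> {0..1}" "\<And>a. value_fun G a v = sink_val G v"
proof -
  have "min_nodes G \<inter> max_nodes G = {}" "min_nodes G \<inter> av_nodes G = {}"
    "min_nodes G \<inter> sink_nodes G = {}" "max_nodes G \<inter> av_nodes G = {}"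
    "max_nodes G \<inter> sink_nodes G = {}" "av_nodes G \<inter> sink_nodes G = {}"
    using assms by (simp_all add: simple_stochastic_game_def)
  then have disjoint: "v \<in> max_nodes G \<Longrightarrow> v \<notin> min_nodes G"
    "v \<in> av_nodes G \<Longrightarrow> v \<notin> min_nodes G \<and> v \<notin> max_nodes G"
    "v \<in> sink_nodes G \<Longrightarrow> v \<notin> min_nodes G \<and> v \<notin> max_nodes G \<and> v \<notin> av_nodes G"
    by blast+
  have "v \<in> min_nodes G \<union> max_nodes G \<union> av_nodes G \<union> sink_nodes G"
    using assms by (simp add: simple_stochastic_game_def)
  then consider "v \<in> min_nodes G" | "v \<in> max_nodes G" | "v \<in> av_nodes G" | "v \<in> sink_nodes G"
    by blast
  then show thesis
  proof cases
    case 1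
    then show thesis
      using assms by (intro that(1)) (simp_all add: simple_stochastic_game_def value_fun_def)
  next
    case 2
    then show thesis
      using assms disjoint(1)
      by (intro that(2)) (simp_all add: simple_stochastic_game_def value_fun_def)
  next
    case 3
    then show thesis using disjoint(2) by (intro that(3)) (simp_all add: value_fun_def)
  next
    case 4
    then show thesis
      using assms disjoint(3)
      by (intro that(4)) (simp_all add: simple_stochastic_game_def value_fun_def)
  qed
qed

lemma sum_pmf_UNIV: "(\<Sum>u\<in>UNIV. pmf p (u::'v::finite)) = 1"
  by (rule sum_pmf_eq_1) auto

text \<open>Minima, maxima and averages with weights of sum 1 are monotone and commute with adding a
  constant. The choice \<open>c = 0\<close> is monotonicity; other values of \<open>c\<close>
  control excesses and amounts of lowering.\<close>

lemma value_fun_nonexpansive: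
  fixes G :: "('v::finite) ssg"
  assumes G: "simple_stochastic_game G" and le: "\<And>u. a u \<le> b u + c" and c: "c \<ge> 0"
  shows "value_fun G a v \<le> value_fun G b v + c"
  using G
proof (cases rule: node_cases[where v=v])
  case min
  have "Min (b ` min_succ G v) \<in> b ` min_succ G v" using min by (intro Min_in) auto
  then obtain u where u: "u \<in> min_succ G v" "Min (b ` min_succ G v) = b u" by auto
  have "Min (a ` min_succ G v) \<le> a u" using u by simp
  then show ?thesis unfolding min(3) u(2) using le[of u] by linarith
next
  case max
  have "a u \<le> Max (b ` max_succ G v) + c" if "u \<in> max_succ G v" for u
  proof -
    have "b u \<le> Max (b ` max_succ G v)" using that by simp
    then show ?thesis using le[of u] by simp
  qed
  then show ?thesis using max by simp
next
  case av
  have "(\<Sum>u\<in>UNIV. pmf (av_dist G v) u * a u) \<le> (\<Sum>u\<in>UNIV. pmf (av_dist G v) u * (b u + c))"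
    by (intro sum_mono mult_left_mono le) simp
  then show ?thesis
    using av by (simp add: algebra_simps sum.distrib sum_distrib_left[symmetric] sum_pmf_UNIV)
next
  case sink
  then show ?thesis using c by simp
qed

lemma value_fun_mono:
  fixes G :: "('v::finite) ssg"
  assumes "simple_stochastic_game G" "a \<le> b"
  shows "value_fun G a \<le> value_fun G b"
  using value_fun_nonexpansive[of G a b 0] assms by (simp add: le_fun_def)

lemma value_fun_valuations:
  fixes G :: "('v::finite) ssg"
  assumes G: "simple_stochastic_game G" and a: "a \<in> valuations"
  shows "value_fun G a \<in> valuations"
proof -
  have bounds: "0 \<le> a u" "a u \<le> 1" for u using a by (auto simp: valuations_def)
  have "value_fun G a v \<in> {0..1}" for v
    using G
  proof (cases rule: node_cases[where v=v])
    case min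
    then have "Min (a ` min_succ G v) \<in> a ` min_succ G v" by (intro Min_in) auto
    then obtain u where "Min (a ` min_succ G v) = a u" by blast
    then show ?thesis using min bounds by simp
  next
    case max
    then have "Max (a ` max_succ G v) \<in> a ` max_succ G v" by (intro Max_in) auto
    then obtain u where "Max (a ` max_succ G v) = a u" by blast
    then show ?thesis using max bounds by simp
  next
    case av
    have "(\<Sum>u\<in>UNIV. pmf (av_dist G v) u * a u) \<le> (\<Sum>u\<in>UNIV. pmf (av_dist G v) u * 1)"
      using bounds by (intro sum_mono mult_left_mono) auto
    then show ?thesis using av bounds by (simp add: sum_nonneg sum_pmf_UNIV)
  qed simp
  then show ?thesis by (simp add: valuations_def)
qed

text \<open>Knaster-Tarski on the unit cube: the pointwise infimum of the prefixpoints is a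
  prefixpoint by monotonicity, and applying \<open>f\<close> to it gives another one, which forces
  equality.\<close>

lemma
  fixes f :: "'v valuation \<Rightarrow> 'v valuation"
  assumes mono: "\<And>a b. a \<le> b \<Longrightarrow> f a \<le> f b"
    and closed: "\<And>a. a \<in> valuations \<Longrightarrow> f a \<in> valuations"
  shows val_lfp_valuations: "val_lfp f \<in> valuations"
    and val_lfp_fixpoint: "f (val_lfp f) = val_lfp f"
    and val_lfp_lowerbound: "\<And>a. a \<in> valuations \<Longrightarrow> f a \<le> a \<Longrightarrow> val_lfp f \<le> a"
proof -
  define P where "P = {a \<in> valuations. f a \<le> a}"
  define l where "l v = (INF a\<in>P. a v)" for v
  \<comment> \<open>The constant 1 makes \<open>P\<close> nonempty and 0 bounds it below, as real
    infima require.\<close>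
  have top: "(\<lambda>v. 1) \<in> P"
    using closed[of "\<lambda>v. 1"] by (auto simp: P_def valuations_def le_fun_def)
  have bdd: "bdd_below ((\<lambda>a. a v) ` P)" for v
    by (intro bdd_belowI[of _ 0]) (auto simp: P_def valuations_def)
  have lower: "l \<le> a" if "a \<in> P" for a
    unfolding le_fun_def l_def using that bdd by (auto intro: cINF_lower)
  have greatest: "b \<le> l" if "\<And>a. a \<in> P \<Longrightarrow> b \<le> a" for b
    unfolding le_fun_def l_def using that top by (auto intro!: cINF_greatest simp: le_fun_def)
  have "(\<lambda>v. 0) \<le> l"
    by (rule greatest) (auto simp: P_def valuations_def le_fun_def)
  then have l: "l \<in> valuations"
    using lower[OF top] by (auto simp: valuations_def le_fun_def)
  have pre: "f l \<le> l"
  proof (rule greatest)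
    fix a assume "a \<in> P"
    then show "f l \<le> a" using mono[OF lower[of a]] by (auto simp: P_def)
  qed
  have fixed: "f l = l"
    using pre lower[of "f l"] mono[OF pre] closed[OF l] by (simp add: P_def)
  have "val_lfp f = l"
    unfolding val_lfp_def
    by (rule Least_equality) (use l fixed lower in \<open>auto simp: P_def\<close>)
  then show "val_lfp f \<in> valuations" "f (val_lfp f) = val_lfp f"
    "\<And>a. a \<in> valuations \<Longrightarrow> f a \<le> a \<Longrightarrow> val_lfp f \<le> a"
    using l fixed lower by (auto simp: P_def)
qed

section \<open>Least fixpoints of the value function, with and without a fixed strategy\<close>

lemma
  fixes G :: "('v::finite) ssg"
  assumes "simple_stochastic_game G"
  shows lfp_value_fun_valuations: "val_lfp (value_fun G) \<in> valuations"
    and lfp_value_fun_fixpoint: "value_fun G (val_lfp (value_fun G)) = val_lfp (value_fun G)"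
    and lfp_value_fun_lowerbound:
      "\<And>a. a \<in> valuations \<Longrightarrow> value_fun G a \<le> a \<Longrightarrow> val_lfp (value_fun G) \<le> a"
  using val_lfp_valuations[of "value_fun G"] val_lfp_fixpoint[of "value_fun G"]
    val_lfp_lowerbound[of "value_fun G"] value_fun_mono[OF assms] value_fun_valuations[OF assms]
  by blast+

lemmas lfp_value_fun_min =
  lfp_value_fun_valuations[OF simple_stochastic_game_restrict_min, unfolded value_fun_restrict_min]
  lfp_value_fun_fixpoint[OF simple_stochastic_game_restrict_min, unfolded value_fun_restrict_min]
  lfp_value_fun_lowerbound[OF simple_stochastic_game_restrict_min, unfolded value_fun_restrict_min]

lemma
  fixes G :: "('v::finite) ssg"
  assumes G: "simple_stochastic_game G"
  shows lfp_value_fun_max: "val_lfp (value_fun_max G \<sigma>) \<in> valuations"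
      "value_fun_max G \<sigma> (val_lfp (value_fun_max G \<sigma>)) = val_lfp (value_fun_max G \<sigma>)"
      "\<And>a. a \<in> valuations \<Longrightarrow> value_fun_max G \<sigma> a \<le> a \<Longrightarrow> val_lfp (value_fun_max G \<sigma>) \<le> a"
    and value_fun_max_nonexpansive:
      "\<And>a b c v. (\<And>u. a u \<le> b u + c) \<Longrightarrow> c \<ge> 0 \<Longrightarrow>
        value_fun_max G \<sigma> a v \<le> value_fun_max G \<sigma> b v + c"
proof -
  note G' = simple_stochastic_game_restrict_max[OF G, of \<sigma>]
  note eq = value_fun_restrict_max[OF G, of \<sigma>]
  show "val_lfp (value_fun_max G \<sigma>) \<in> valuations"
    "value_fun_max G \<sigma> (val_lfp (value_fun_max G \<sigma>)) = val_lfp (value_fun_max G \<sigma>)"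
    "\<And>a. a \<in> valuations \<Longrightarrow> value_fun_max G \<sigma> a \<le> a \<Longrightarrow> val_lfp (value_fun_max G \<sigma>) \<le> a"
    using lfp_value_fun_valuations[OF G'] lfp_value_fun_fixpoint[OF G']
      lfp_value_fun_lowerbound[OF G'] unfolding eq by auto
  show "\<And>a b c v. (\<And>u. a u \<le> b u + c) \<Longrightarrow> c \<ge> 0 \<Longrightarrow>
      value_fun_max G \<sigma> a v \<le> value_fun_max G \<sigma> b v + c"
    using value_fun_nonexpansive[OF G'] unfolding eq by auto
qed

subsection \<open>Lowering a valuation where it exceeds another one the most\<close>

text \<open>By nonexpansiveness the excess at \<open>v\<close> is at most \<theta>. Where it equals
  \<theta>, it comes from nodes of maximal excess: the \<open>b\<close>-minimal successors of a Min
  node, the \<open>a\<close>-maximal successors of a Max node, and the whole support of a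
  distribution. A small enough \<epsilon> keeps the other successors of a Max node from taking
  over.\<close>

lemma value_fun_lower_max_excess:
  fixes G :: "('v::finite) ssg"
  assumes G: "simple_stochastic_game G" and b: "b \<in> valuations"
    and \<theta>: "\<theta> > 0" and le: "\<And>u. a u \<le> b u + \<theta>"
  shows "\<exists>\<epsilon>>0. \<epsilon> \<le> \<theta> \<and> (\<forall>v. value_fun G a v = value_fun G b v + \<theta> \<longrightarrow>
           value_fun G (\<lambda>u. a u \<ominus> on_set \<epsilon> {u. a u = b u + \<theta>} u) v \<le> value_fun G a v - \<epsilon>)"
proof -
  define X where "X = {u. a u = b u + \<theta>}"
  \<comment> \<open>Bounds on \<epsilon>: all positive differences between two values of
    \<open>a\<close>, and \<theta> itself. The latter keeps the set nonempty and prevents truncation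
    at 0 on \<open>X\<close>.\<close>
  define D where "D = insert \<theta> ((\<lambda>(u, v). a v - a u) ` {(u, v). a u < a v})"
  define \<epsilon> where "\<epsilon> = Min D"
  define a' where "a' u = a u \<ominus> on_set \<epsilon> X u" for u
  have fin: "finite D" by (simp add: D_def)
  have "\<epsilon> \<in> D" unfolding \<epsilon>_def by (rule Min_in[OF fin]) (simp add: D_def)
  then have pos: "\<epsilon> > 0" using \<theta> by (auto simp: D_def)
  have small: "\<epsilon> \<le> \<theta>" unfolding \<epsilon>_def using fin by (simp add: D_def)
  have gap: "a u \<le> a v - \<epsilon>" if "a u < a v" for u v
  proof -
    have "\<epsilon> \<le> a v - a u" unfolding \<epsilon>_def by (rule Min_le[OF fin]) (use that in \<open>auto simp: D_def\<close>)
    then show ?thesis by simp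
  qed
  have bnn: "b u \<ge> 0" for u using b by (auto simp: valuations_def)
  have on_X: "a' u = a u - \<epsilon>" if "u \<in> X" for u
    using that small bnn[of u] by (auto simp: a'_def X_def tminus_def on_set_def)
  \<comment> \<open>Outside \<open>X\<close> the valuation \<open>a\<close> may be negative, and
    then truncation acts.\<close>
  have off_X: "a' u = max 0 (a u)" if "u \<notin> X" for u
    using that by (auto simp: a'_def tminus_def on_set_def)
  have "value_fun G a' v \<le> value_fun G a v - \<epsilon>" if eq: "value_fun G a v = value_fun G b v + \<theta>" for v
    using G
  proof (cases rule: node_cases[where v=v])
    case min
    then have "Min (b ` min_succ G v) \<in> b ` min_succ G v" by (intro Min_in) auto
    then obtain u where u: "u \<in> min_succ G v" "Min (b ` min_succ G v) = b u" by auto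
    have au: "Min (a ` min_succ G v) \<le> a u" using u by simp
    \<comment> \<open>The value \<open>a u\<close> lies between the minimum of \<open>a\<close> over
      the successors and \<open>b u + \<theta>\<close>, and these two coincide.\<close>
    then have X: "u \<in> X" using le[of u] eq[unfolded min(3) u(2)] unfolding X_def by simp
    have "Min (a' ` min_succ G v) \<le> a' u" using u by simp
    then show ?thesis
      unfolding min(3) using on_X[OF X] le[of u] eq[unfolded min(3) u(2)] by linarith
  next
    case max
    then have "Max (a ` max_succ G v) \<in> a ` max_succ G v" by (intro Max_in) auto
    then obtain w where w: "w \<in> max_succ G v" "Max (a ` max_succ G v) = a w" by auto
    have bw: "b u \<le> a w - \<theta>" if "u \<in> max_succ G v" for u
    proof -
      have "b u \<le> Max (b ` max_succ G v)" using that by simp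
      then show ?thesis using eq max w by simp
    qed
    have "a' u \<le> a w - \<epsilon>" if u: "u \<in> max_succ G v" for u
    proof (cases "u \<in> X")
      case True
      then show ?thesis using on_X[of u] bw[OF u] by (simp add: X_def)
    next
      case False
      \<comment> \<open>Outside \<open>X\<close> the excess is below \<theta>, so \<open>a u\<close>
        falls short of the maximum \<open>a w\<close>, and by \<open>gap\<close> it does so by at
        least \<epsilon>.\<close>
      then have "a u < a w" using le[of u] bw[OF u] by (simp add: X_def less_le)
      then show ?thesis using off_X[OF False] gap[of u w] bw[OF u] bnn[of u] small by simp
    qed
    then show ?thesis using max w by simp
  next
    case av
    define p where "p = pmf (av_dist G v)"
    have p: "(\<Sum>u\<in>UNIV. p u) = 1" "p u \<ge> 0" for u by (simp_all add: p_def sum_pmf_UNIV)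
    \<comment> \<open>The average slack vanishes and its terms are nonnegative, so every node of
      positive probability lies in \<open>X\<close>.\<close>
    have "(\<Sum>u\<in>UNIV. p u * (b u + \<theta> - a u)) = 0"
      using eq av p(1)
      by (simp add: p_def algebra_simps sum.distrib sum_subtractf sum_distrib_left[symmetric])
    then have "p u * (b u + \<theta> - a u) = 0" for u
      using sum_nonneg_eq_0_iff[of UNIV "\<lambda>u. p u * (b u + \<theta> - a u)"] p(2) le by simp
    then have p_X: "p u = 0 \<or> b u + \<theta> - a u = 0" for u unfolding mult_eq_0_iff .
    have "p u * a' u = p u * (a u - \<epsilon>)" for u
    proof (cases "p u = 0")
      case False
      then have "u \<in> X" using p_X[of u] by (simp add: X_def)
      then show ?thesis by (simp add: on_X)
    qed simp
    then have "(\<Sum>u\<in>UNIV. p u * a' u) = (\<Sum>u\<in>UNIV. p u * a u) - \<epsilon>"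
      using p(1) by (simp add: right_diff_distrib sum_subtractf sum_distrib_right[symmetric])
    then show ?thesis using av by (simp add: p_def)
  next
    case sink
    then show ?thesis using eq \<theta> by simp
  qed
  then show ?thesis using pos small unfolding a'_def X_def by blast
qed

lemma max_excess:
  fixes a b :: "'v::finite \<Rightarrow> real"
  assumes "\<not> a \<le> b"
  obtains \<theta> v where "\<theta> > 0" "\<And>u. a u \<le> b u + \<theta>" "a v = b v + \<theta>"
proof -
  define \<theta> where "\<theta> = Max (range (\<lambda>u. a u - b u))"
  have ge: "a u - b u \<le> \<theta>" for u by (simp add: \<theta>_def)
  obtain w where "a w > b w" using assms by (auto simp: le_fun_def not_le)
  then have "\<theta> > 0" using ge[of w] by simp
  have "\<theta> \<in> range (\<lambda>u. a u - b u)" unfolding \<theta>_def by (rule Max_in) auto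
  then obtain v where "\<theta> = a v - b v" by auto
  then have "a v = b v + \<theta>" by simp
  then show thesis using that[OF \<open>\<theta> > 0\<close> _ \<open>a v = b v + \<theta>\<close>] ge by (simp add: algebra_simps)
qed

text \<open>On \<open>X\<close> the prefixpoint inequality is \<open>dec\<close>, elsewhere it
  follows from monotonicity. The approximation subtracts with truncation and the algorithm without;
  both agree here.\<close>

lemma prefixpoint_lowered:
  fixes G :: "('v::finite) ssg"
  assumes G: "simple_stochastic_game G" and a: "a \<in> valuations" "value_fun G a \<le> a"
    and \<theta>: "\<theta> > 0" and X: "X \<noteq> {}"
    and dec: "\<And>v. v \<in> X \<Longrightarrow> value_fun G (\<lambda>u. a u \<ominus> on_set \<theta> X u) v \<le> a v - \<theta>"
  defines "a' \<equiv> \<lambda>v. a v - on_set \<theta> X v"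
  shows "a' \<in> valuations" "value_fun G a' \<le> a'" "a' < a"
proof -
  define t where "t = (\<lambda>u. a u \<ominus> on_set \<theta> X u)"
  have a01: "0 \<le> a u" "a u \<le> 1" for u using a by (auto simp: valuations_def)
  have "a u - \<theta> \<le> 1" for u using a01(2)[of u] \<theta> by linarith
  then have t: "t \<in> valuations"
    using a01 by (auto simp: t_def valuations_def tminus_def on_set_def)
  \<comment> \<open>The value function is nonnegative on valuations, so \<open>dec\<close> forces
    \<open>a v\<close> to be at least \<theta>: truncation never acts on \<open>X\<close>.\<close>
  have ge: "a v \<ge> \<theta>" if "v \<in> X" for v
  proof -
    have "value_fun G t v \<ge> 0"
      using value_fun_valuations[OF G t] by (auto simp: valuations_def)
    then show ?thesis using dec[OF that] by (simp add: t_def)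
  qed
  have t_eq: "t = a'"
    using ge a01 by (auto simp: t_def a'_def tminus_def on_set_def)
  show "a' \<in> valuations" using t t_eq by simp
  have le: "a' \<le> a" using \<theta> by (auto simp: a'_def on_set_def le_fun_def)
  show "value_fun G a' \<le> a'"
  proof (rule le_funI)
    fix v
    show "value_fun G a' v \<le> a' v"
    proof (cases "v \<in> X")
      case True
      then show ?thesis using dec t_eq by (simp add: t_def a'_def on_set_def)
    next
      case False
      have "value_fun G a' v \<le> value_fun G a v"
        using value_fun_mono[OF G le] by (simp add: le_fun_def)
      also have "\<dots> \<le> a v" using a(2) by (simp add: le_fun_def)
      finally show ?thesis using False by (simp add: a'_def on_set_def)
    qed
  qed
  obtain v where "v \<in> X" using X by auto
  then have "a' v \<noteq> a v" using \<theta> by (simp add: a'_def on_set_def)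
  then show "a' < a" using le by (auto simp: less_le)
qed

subsection \<open>The approximation of the value function\<close>

text \<open>Lowering by \<open>\<theta>'\<close> instead of \<theta> raises the resulting value by
  at most \<open>\<theta> - \<theta>'\<close>, so a decrease of at least \<open>\<theta>'\<close>
  remains.\<close>

lemma approx_at_antimono:
  fixes G :: "('v::finite) ssg"
  assumes G: "simple_stochastic_game G" and v: "v \<in> approx_at (value_fun G) a \<theta> X"
    and le: "0 \<le> \<theta>'" "\<theta>' \<le> \<theta>"
  shows "v \<in> approx_at (value_fun G) a \<theta>' X"
proof -
  have "value_fun G (\<lambda>u. a u \<ominus> on_set \<theta>' X u) v
      \<le> value_fun G (\<lambda>u. a u \<ominus> on_set \<theta> X u) v + (\<theta> - \<theta>')"
    by (rule value_fun_nonexpansive[OF G]) (use le in \<open>auto simp: tminus_def on_set_def\<close>)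
  then show ?thesis using v le by (auto simp: approx_at_def tminus_def max_def split: if_splits)
qed

text \<open>The maximum defining \<open>iota_node\<close> exists: the admissible amounts include 0
  and are bounded, and their supremum is again admissible.\<close>

lemma iota_node_greatest:
  fixes G :: "('v::finite) ssg"
  assumes G: "simple_stochastic_game G" and v: "v \<in> support (value_fun G a)"
  shows "iota_node (value_fun G) a X v \<in> {0..1}"
    and "v \<in> approx_at (value_fun G) a (iota_node (value_fun G) a X v) X"
    and "\<And>\<theta>. \<theta> \<in> {0..1} \<Longrightarrow> v \<in> approx_at (value_fun G) a \<theta> X \<Longrightarrow>
           \<theta> \<le> iota_node (value_fun G) a X v"
proof -
  define T where "T = {\<theta> \<in> {0..1}. v \<in> approx_at (value_fun G) a \<theta> X}"
  define s where "s = Sup T"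
  have T0: "0 \<in> T" using v by (simp add: T_def approx_at_def tminus_def)
  have bdd: "bdd_above T" by (rule bdd_aboveI[of _ 1]) (simp add: T_def)
  have upper: "\<theta> \<le> s" if "\<theta> \<in> T" for \<theta> unfolding s_def using that bdd by (rule cSup_upper)
  have s01: "s \<in> {0..1}"
  proof -
    have "s \<le> 1" unfolding s_def by (rule cSup_least) (use T0 in blast, simp add: T_def)
    then show ?thesis using upper[OF T0] by simp
  qed
  have "s \<le> value_fun G a v \<ominus> value_fun G (\<lambda>u. a u \<ominus> on_set s X u) v"
    unfolding s_def
  proof (rule cSup_least)
    \<comment> \<open>Lowering by the supremum \<open>s\<close> decreases the value at least as much
      as lowering by an admissible \<theta>, hence by at least \<theta>. Taking the supremum over
      \<theta> shows that \<open>s\<close> is admissible.\<close>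
    fix \<theta> assume \<theta>: "\<theta> \<in> T"
    have "(\<lambda>u. a u \<ominus> on_set s X u) \<le> (\<lambda>u. a u \<ominus> on_set \<theta> X u)"
      using upper[OF \<theta>] by (auto simp: le_fun_def tminus_def on_set_def)
    then have "value_fun G (\<lambda>u. a u \<ominus> on_set s X u) v \<le> value_fun G (\<lambda>u. a u \<ominus> on_set \<theta> X u) v"
      using value_fun_mono[OF G] by (simp add: le_fun_def)
    then show "\<theta> \<le> value_fun G a v \<ominus> value_fun G (\<lambda>u. a u \<ominus> on_set (Sup T) X u) v"
      using \<theta> by (simp add: T_def approx_at_def tminus_def s_def le_max_iff_disj) linarith
  qed (use T0 in auto)
  then have sT: "s \<in> T" using s01 v by (simp add: T_def approx_at_def)
  have "iota_node (value_fun G) a X v = s"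
    unfolding iota_node_def
    by (rule Greatest_equality) (use sT upper in \<open>auto simp: T_def\<close>)
  then show "iota_node (value_fun G) a X v \<in> {0..1}"
    "v \<in> approx_at (value_fun G) a (iota_node (value_fun G) a X v) X"
    "\<And>\<theta>. \<theta> \<in> {0..1} \<Longrightarrow> v \<in> approx_at (value_fun G) a \<theta> X \<Longrightarrow>
       \<theta> \<le> iota_node (value_fun G) a X v"
    using sT upper by (auto simp: T_def)
qed

lemma delta_bounds:
  assumes "(a::('v::finite) valuation) \<in> valuations"
  shows "0 < delta a" "delta a \<le> 1"
proof -
  have "0 < delta a \<and> delta a \<le> 1"
  proof (cases "support a = {}")
    case True
    then show ?thesis by (simp add: delta_def unit_min_def)
  next
    case False
    then have "Min (a ` support a) \<in> a ` support a" by (intro Min_in) auto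
    then obtain u where "u \<in> support a" "Min (a ` support a) = a u" by blast
    then show ?thesis
      using assms False by (auto simp: delta_def unit_min_def support_def valuations_def less_le)
  qed
  then show "0 < delta a" "delta a \<le> 1" by auto
qed

text \<open>The threshold \<open>iota\<close> is a minimum of finitely many positive numbers, with
  \<open>delta a\<close> keeping the set nonempty. Being positive and below every nonzero
  \<open>iota_node\<close>, it detects any positive decrease, however small.\<close>

lemma iota_bounds:
  fixes G :: "('v::finite) ssg"
  assumes G: "simple_stochastic_game G" and a: "a \<in> valuations"
  shows "0 < iota (value_fun G) a" "iota (value_fun G) a \<le> 1"
    and "\<And>X v. X \<subseteq> support a \<Longrightarrow> v \<in> support (value_fun G a) \<Longrightarrow>
      iota_node (value_fun G) a X v \<noteq> 0 \<Longrightarrow> iota (value_fun G) a \<le> iota_node (value_fun G) a X v"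
proof -
  define S where "S = {iota_node (value_fun G) a X v | X v.
     X \<subseteq> support a \<and> v \<in> support (value_fun G a) \<and> iota_node (value_fun G) a X v \<noteq> 0} \<union> {delta a}"
  have iota: "iota (value_fun G) a = Min S" by (simp add: iota_def S_def)
  have "S \<subseteq> range (\<lambda>(X, v). iota_node (value_fun G) a X v) \<union> {delta a}"
    by (auto simp: S_def)
  then have fin: "finite S" by (rule finite_subset) simp
  have "Min S \<in> S" by (rule Min_in[OF fin]) (simp add: S_def)
  moreover have "x > 0" if "x \<in> S" for x
    using that delta_bounds[OF a] iota_node_greatest(1)[OF G] by (force simp: S_def less_le)
  ultimately show "0 < iota (value_fun G) a" using iota by simp
  have "Min S \<le> delta a" by (rule Min_le[OF fin]) (simp add: S_def)
  then show "iota (value_fun G) a \<le> 1" using iota delta_bounds[OF a] by simp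
  show "iota (value_fun G) a \<le> iota_node (value_fun G) a X v"
    if "X \<subseteq> support a" "v \<in> support (value_fun G a)" "iota_node (value_fun G) a X v \<noteq> 0" for X v
    unfolding iota by (rule Min_le[OF fin]) (use that in \<open>auto simp: S_def\<close>)
qed

text \<open>All fixpoints of such an \<open>f\<close> are subsets of \<open>A\<close>, so
  restricting to the powerset of \<open>A\<close> loses none and the theory of \<open>gfp\<close>
  applies.\<close>

lemma pow_gfp_eq_gfp:
  assumes "mono f" "\<And>X. f X \<subseteq> A"
  shows "pow_gfp A f = gfp f"
  unfolding pow_gfp_def
proof (rule Greatest_equality)
  show "gfp f \<subseteq> A \<and> f (gfp f) = gfp f"
    using gfp_unfold[OF assms(1)] assms(2)[of "gfp f"] by auto
next
  fix X assume "X \<subseteq> A \<and> f X = X"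
  then show "X \<subseteq> gfp f" by (intro gfp_upperbound) simp
qed

text \<open>A larger set lowers \<open>a\<close> at more nodes and so lowers the value function
  further.\<close>

lemma approx_mono:
  fixes G :: "('v::finite) ssg"
  assumes G: "simple_stochastic_game G" and a: "a \<in> valuations"
  shows "mono (approx (value_fun G) a)"
proof (rule monoI)
  fix X Y :: "'v set" assume XY: "X \<subseteq> Y"
  let ?i = "iota (value_fun G) a"
  have "(\<lambda>u. a u \<ominus> on_set ?i Y u) \<le> (\<lambda>u. a u \<ominus> on_set ?i X u)"
    using XY iota_bounds(1)[OF G a] by (auto simp: le_fun_def tminus_def on_set_def)
  then have "value_fun G (\<lambda>u. a u \<ominus> on_set ?i Y u) v \<le> value_fun G (\<lambda>u. a u \<ominus> on_set ?i X u) v" for v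
    using value_fun_mono[OF G] by (simp add: le_fun_def)
  then have "value_fun G a v \<ominus> value_fun G (\<lambda>u. a u \<ominus> on_set ?i X u) v
      \<le> value_fun G a v \<ominus> value_fun G (\<lambda>u. a u \<ominus> on_set ?i Y u) v" for v
    unfolding tminus_def using max.mono[OF order_refl diff_left_mono] by blast
  then show "approx (value_fun G) a X \<subseteq> approx (value_fun G) a Y"
    unfolding approx_def approx_at_def by (auto intro: order_trans)
qed

text \<open>At a fixpoint, the supports of \<open>a\<close> and \<open>value_fun G a\<close>
  coincide, so the approximation stays inside \<open>support a\<close>.\<close>

lemma pow_gfp_approx:
  fixes G :: "('v::finite) ssg"
  assumes "simple_stochastic_game G" "a \<in> valuations" "value_fun G a = a"
  shows "pow_gfp (support a) (approx (value_fun G) a) = gfp (approx (value_fun G) a)"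
  by (rule pow_gfp_eq_gfp[OF approx_mono[OF assms(1,2)]])
    (auto simp: approx_def approx_at_def assms(3))

text \<open>Otherwise the nodes where \<open>a\<close> exceeds the least fixpoint the most would
  form a nonempty postfixpoint of the approximation.\<close>

lemma gfp_approx_empty_imp_lfp:
  fixes G :: "('v::finite) ssg"
  assumes G: "simple_stochastic_game G" and a: "a \<in> valuations" and fixed: "value_fun G a = a"
    and empty: "gfp (approx (value_fun G) a) = {}"
  shows "a = val_lfp (value_fun G)"
proof (rule ccontr)
  define b where "b = val_lfp (value_fun G)"
  have b: "b \<in> valuations" "value_fun G b = b" "b \<le> a"
    using lfp_value_fun_valuations[OF G] lfp_value_fun_fixpoint[OF G]
      lfp_value_fun_lowerbound[OF G a] fixed by (simp_all add: b_def)
  assume "a \<noteq> val_lfp (value_fun G)"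
  then have "\<not> a \<le> b" using b(3) by (auto simp: b_def)
  then obtain \<theta> v where \<theta>: "\<theta> > 0" "\<And>u. a u \<le> b u + \<theta>" "a v = b v + \<theta>"
    by (rule max_excess) blast
  define X where "X = {u. a u = b u + \<theta>}"
  obtain \<epsilon> where \<epsilon>: "\<epsilon> > 0" "\<epsilon> \<le> \<theta>"
    and dec: "\<And>u. u \<in> X \<Longrightarrow> value_fun G (\<lambda>u. a u \<ominus> on_set \<epsilon> X u) u \<le> a u - \<epsilon>"
    using value_fun_lower_max_excess[OF G b(1) \<theta>(1,2)] unfolding fixed b(2) X_def by auto
  have b0: "b u \<ge> 0" for u using b(1) by (auto simp: valuations_def)
  \<comment> \<open>Since \<open>b\<close> is nonnegative, \<open>a\<close> is at least \<theta> on
    \<open>X\<close>, hence nonzero.\<close>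
  have supp: "X \<subseteq> support a"
    using b0 \<theta>(1) by (auto simp: X_def support_def add_nonneg_eq_0_iff)
  have "a v \<le> 1" using a by (auto simp: valuations_def)
  then have \<epsilon>1: "\<epsilon> \<in> {0..1}" using \<epsilon> \<theta>(3) b0[of v] by auto
  have "X \<subseteq> approx (value_fun G) a X"
  proof
    fix u assume u: "u \<in> X"
    have us: "u \<in> support (value_fun G a)" using u supp fixed by auto
    have "u \<in> approx_at (value_fun G) a \<epsilon> X"
      using dec[OF u] us fixed by (simp add: approx_at_def tminus_def)
    \<comment> \<open>The amount \<epsilon> may be smaller than \<open>iota\<close>; it only shows
      that \<open>iota_node\<close> is nonzero. Then \<open>iota\<close> is at most
      \<open>iota_node\<close>, and antimonotonicity makes \<open>iota\<close> itself
      admissible.\<close>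
    then have "\<epsilon> \<le> iota_node (value_fun G) a X u"
      by (rule iota_node_greatest(3)[OF G us \<epsilon>1])
    then have "iota (value_fun G) a \<le> iota_node (value_fun G) a X u"
      using iota_bounds(3)[OF G a supp us] \<epsilon>(1) by simp
    then show "u \<in> approx (value_fun G) a X"
      unfolding approx_def
      using approx_at_antimono[OF G iota_node_greatest(2)[OF G us]] iota_bounds(1)[OF G a] by simp
  qed
  then have "X \<subseteq> gfp (approx (value_fun G) a)" by (rule gfp_upperbound)
  then show False using empty \<theta>(3) by (auto simp: X_def)
qed

text \<open>The amount subtracted is the least \<open>iota_node\<close> over \<open>X\<close>:
  admissible at each node of \<open>X\<close>, and positive because \<open>X\<close> is a fixpoint
  of the approximation.\<close>

lemma gfp_approx_lowered:
  fixes G :: "('v::finite) ssg"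
  assumes G: "simple_stochastic_game G" and a: "a \<in> valuations" and fixed: "value_fun G a = a"
    and X: "X = gfp (approx (value_fun G) a)" "X \<noteq> {}"
  defines "a' \<equiv> \<lambda>v. a v - on_set (iota_set (value_fun G) a X) X v"
  shows "a' \<in> valuations" "value_fun G a' \<le> a'" "a' < a"
proof -
  define \<theta> where "\<theta> = iota_set (value_fun G) a X"
  have \<theta>_eq: "\<theta> = Min (iota_node (value_fun G) a X ` X)"
    using X(2) by (simp add: \<theta>_def iota_set_def unit_min_def)
  have Xfix: "X = approx (value_fun G) a X"
    unfolding X(1) by (rule gfp_unfold[OF approx_mono[OF G a]])
  have supp: "v \<in> support (value_fun G a)" if "v \<in> X" for v
    using that Xfix by (auto simp: approx_def approx_at_def)
  \<comment> \<open>Membership of \<open>v\<close> in the approximation says that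
    \<open>iota\<close> is admissible at \<open>v\<close>, so the greatest admissible amount is no
    smaller.\<close>
  have "iota (value_fun G) a \<le> iota_node (value_fun G) a X v" if "v \<in> X" for v
    by (rule iota_node_greatest(3)[OF G supp[OF that]])
      (use that Xfix iota_bounds(1,2)[OF G a] in \<open>auto simp: approx_def\<close>)
  then have pos: "\<theta> > 0"
    unfolding \<theta>_eq using X(2) iota_bounds(1)[OF G a] by (auto intro: less_le_trans)
  have "value_fun G (\<lambda>u. a u \<ominus> on_set \<theta> X u) v \<le> a v - \<theta>" if "v \<in> X" for v
  proof -
    have "\<theta> \<le> iota_node (value_fun G) a X v" unfolding \<theta>_eq using that by simp
    then have "v \<in> approx_at (value_fun G) a \<theta> X"
      using approx_at_antimono[OF G iota_node_greatest(2)[OF G supp[OF that]]] pos by simp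
    then show ?thesis using pos fixed by (auto simp: approx_at_def tminus_def max_def split: if_splits)
  qed
  from prefixpoint_lowered[OF G a _ pos X(2) this] fixed
  show "a' \<in> valuations" "value_fun G a' \<le> a'" "a' < a"
    by (simp_all add: a'_def \<theta>_def)
qed

subsection \<open>Switching\<close>

lemma Min_le_min_strategy:
  fixes a :: "('v::finite) valuation"
  assumes "\<tau> \<in> min_strategies G" "v \<in> min_nodes G"
  shows "Min (a ` min_succ G v) \<le> a (\<tau> v)"
  using assms PiE_mem[of \<tau> "min_nodes G" "min_succ G" v] by (simp add: min_strategies_def)

lemma max_strategy_le_Max:
  fixes a :: "('v::finite) valuation"
  assumes "\<sigma> \<in> max_strategies G" "v \<in> max_nodes G"
  shows "a (\<sigma> v) \<le> Max (a ` max_succ G v)"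
  using assms PiE_mem[of \<sigma> "max_nodes G" "max_succ G" v] by (simp add: max_strategies_def)

lemma value_fun_min_node: "v \<in> min_nodes G \<Longrightarrow> value_fun G a v = Min (a ` min_succ G v)"
  by (simp add: value_fun_def)

lemma value_fun_max_node:
  assumes "simple_stochastic_game G" "v \<in> max_nodes G"
  shows "value_fun G a v = Max (a ` max_succ G v)"
  using max_node_not_min_node[OF assms] assms(2) by (simp add: value_fun_def)

lemma value_fun_le_value_fun_min:
  fixes G :: "('v::finite) ssg"
  assumes "\<tau> \<in> min_strategies G"
  shows "value_fun G a \<le> value_fun_min G \<tau> a"
  using Min_le_min_strategy[OF assms]
  by (simp add: le_fun_def value_fun_min_def value_fun_min_node)

lemma value_fun_max_le_value_fun:
  fixes G :: "('v::finite) ssg"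
  assumes "simple_stochastic_game G" "\<sigma> \<in> max_strategies G"
  shows "value_fun_max G \<sigma> a \<le> value_fun G a"
  using max_strategy_le_Max[OF assms(2)]
  by (simp add: le_fun_def value_fun_max_def value_fun_max_node[OF assms(1)])

lemma is_arg_min_eq_Min:
  fixes a :: "'v::finite \<Rightarrow> real"
  shows "is_arg_min a (\<lambda>u. u \<in> S) u \<longleftrightarrow> u \<in> S \<and> a u = Min (a ` S)"
  by (auto simp: is_arg_min_linorder intro!: Min_eqI[symmetric])

lemma is_arg_max_eq_Max:
  fixes a :: "'v::finite \<Rightarrow> real"
  shows "is_arg_max a (\<lambda>u. u \<in> S) u \<longleftrightarrow> u \<in> S \<and> a u = Max (a ` S)"
  by (auto simp: is_arg_max_linorder intro!: Max_eqI[symmetric])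

text \<open>The new strategy is \<open>a\<close>-optimal at every Min node: at switch nodes by
  choice, elsewhere because no strict improvement existed. This serves both the ordinary switch and
  the one after a decrease.\<close>

lemma value_fun_sw_min:
  fixes G :: "('v::finite) ssg"
  assumes "\<tau> \<in> min_strategies G" "\<tau>' \<in> sw_min G \<tau> a"
  shows "value_fun_min G \<tau>' a = value_fun G a"
proof
  fix v
  show "value_fun_min G \<tau>' a v = value_fun G a v"
  proof (cases "v \<in> min_nodes G")
    case True
    then have "if Min (a ` min_succ G v) < a (\<tau> v)
        then is_arg_min a (\<lambda>u. u \<in> min_succ G v) (\<tau>' v) else \<tau>' v = \<tau> v"
      using assms(2) unfolding sw_min_def by blast
    then have "a (\<tau>' v) = Min (a ` min_succ G v)"
      using Min_le_min_strategy[OF assms(1) True, of a]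
      by (simp add: is_arg_min_eq_Min split: if_splits)
    then show ?thesis using True by (simp add: value_fun_min_def value_fun_min_node)
  qed (simp add: value_fun_min_def)
qed

lemma value_fun_sw_max:
  fixes G :: "('v::finite) ssg"
  assumes "simple_stochastic_game G" "\<sigma> \<in> max_strategies G" "\<sigma>' \<in> sw_max G \<sigma> a"
  shows "value_fun_max G \<sigma>' a = value_fun G a"
proof
  fix v
  show "value_fun_max G \<sigma>' a v = value_fun G a v"
  proof (cases "v \<in> max_nodes G")
    case True
    then have "if Max (a ` max_succ G v) > a (\<sigma> v)
        then is_arg_max a (\<lambda>u. u \<in> max_succ G v) (\<sigma>' v) else \<sigma>' v = \<sigma> v"
      using assms(3) unfolding sw_max_def by blast
    then have "a (\<sigma>' v) = Max (a ` max_succ G v)"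
      using max_strategy_le_Max[OF assms(2) True, of a]
      by (simp add: is_arg_max_eq_Max split: if_splits)
    then show ?thesis using True by (simp add: value_fun_max_def value_fun_max_node[OF assms(1)])
  qed (simp add: value_fun_max_def)
qed

text \<open>Guarantees that a run never gets stuck for want of a switch.\<close>

lemma sw_min_nonempty:
  fixes G :: "('v::finite) ssg"
  assumes G: "simple_stochastic_game G" and \<tau>: "\<tau> \<in> min_strategies G"
  shows "sw_min G \<tau> a \<noteq> {}"
proof -
  have "\<exists>u. u \<in> min_succ G v \<and> a u = Min (a ` min_succ G v)" if "v \<in> min_nodes G" for v
  proof -
    have "Min (a ` min_succ G v) \<in> a ` min_succ G v"
      using G that by (intro Min_in) (auto simp: simple_stochastic_game_def)
    then show ?thesis by (auto simp: image_iff)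
  qed
  then obtain m where
    m: "\<And>v. v \<in> min_nodes G \<Longrightarrow> m v \<in> min_succ G v \<and> a (m v) = Min (a ` min_succ G v)"
    by metis
  have "(\<lambda>v\<in>min_nodes G. if Min (a ` min_succ G v) < a (\<tau> v) then m v else \<tau> v) \<in> sw_min G \<tau> a"
    using m \<tau> by (auto simp: sw_min_def min_strategies_def is_arg_min_eq_Min)
  then show ?thesis by blast
qed

lemma sw_max_nonempty:
  fixes G :: "('v::finite) ssg"
  assumes G: "simple_stochastic_game G" and \<sigma>: "\<sigma> \<in> max_strategies G"
  shows "sw_max G \<sigma> a \<noteq> {}"
proof -
  have "\<exists>u. u \<in> max_succ G v \<and> a u = Max (a ` max_succ G v)" if "v \<in> max_nodes G" for v
  proof -
    have "Max (a ` max_succ G v) \<in> a ` max_succ G v"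
      using G that by (intro Max_in) (auto simp: simple_stochastic_game_def)
    then show ?thesis by (auto simp: image_iff)
  qed
  then obtain m where
    m: "\<And>v. v \<in> max_nodes G \<Longrightarrow> m v \<in> max_succ G v \<and> a (m v) = Max (a ` max_succ G v)"
    by metis
  have "(\<lambda>v\<in>max_nodes G. if Max (a ` max_succ G v) > a (\<sigma> v) then m v else \<sigma> v) \<in> sw_max G \<sigma> a"
    using m \<sigma> by (auto simp: sw_max_def max_strategies_def is_arg_max_eq_Max)
  then show ?thesis by blast
qed

section \<open>Strict progress of the least fixpoints under switching\<close>

lemma sw_min_not_fixpoint:
  fixes G :: "('v::finite) ssg"
  assumes \<tau>: "\<tau> \<in> min_strategies G" and a: "value_fun_min G \<tau> a = a"
    and \<tau>': "\<tau>' \<in> sw_min G \<tau> a" "\<tau>' \<noteq> \<tau>"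
  shows "value_fun G a \<noteq> a"
proof
  assume fixed: "value_fun G a = a"
  \<comment> \<open>A common fixpoint of both functions makes \<open>a (\<tau> v)\<close> the
    minimum over the successors, so \<open>v\<close> is not a switch node.\<close>
  have "\<tau>' v = \<tau> v" if v: "v \<in> min_nodes G" for v
    using \<tau>'(1) v fun_cong[OF a, of v] fun_cong[OF fixed, of v]
    by (auto simp: sw_min_def value_fun_min_def value_fun_def)
  then have "\<tau>' = \<tau>"
    using \<tau> \<tau>'(1) by (intro PiE_ext[of _ "min_nodes G" "min_succ G"])
      (auto simp: sw_min_def min_strategies_def)
  then show False using \<tau>'(2) by simp
qed

lemma sw_max_not_fixpoint:
  fixes G :: "('v::finite) ssg"
  assumes G: "simple_stochastic_game G"
    and \<sigma>: "\<sigma> \<in> max_strategies G" and a: "value_fun_max G \<sigma> a = a"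
    and \<sigma>': "\<sigma>' \<in> sw_max G \<sigma> a" "\<sigma>' \<noteq> \<sigma>"
  shows "value_fun G a \<noteq> a"
proof
  assume fixed: "value_fun G a = a"
  have "\<sigma>' v = \<sigma> v" if v: "v \<in> max_nodes G" for v
  proof -
    have "v \<notin> min_nodes G" by (rule max_node_not_min_node[OF G v])
    then show ?thesis using \<sigma>'(1) v fun_cong[OF a, of v] fun_cong[OF fixed, of v]
      by (auto simp: sw_max_def value_fun_max_def value_fun_def)
  qed
  then have "\<sigma>' = \<sigma>"
    using \<sigma> \<sigma>'(1) by (intro PiE_ext[of _ "max_nodes G" "max_succ G"])
      (auto simp: sw_max_def max_strategies_def)
  then show False using \<sigma>'(2) by simp
qed

text \<open>The old least fixpoint is a prefixpoint of the new function, since switching only lowers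
  values at it, but it is not a fixpoint.\<close>

lemma lfp_sw_min_less:
  fixes G :: "('v::finite) ssg"
  assumes G: "simple_stochastic_game G" and \<tau>: "\<tau> \<in> min_strategies G"
    and \<tau>': "\<tau>' \<in> sw_min G \<tau> (val_lfp (value_fun_min G \<tau>))" "\<tau>' \<noteq> \<tau>"
  shows "val_lfp (value_fun_min G \<tau>') < val_lfp (value_fun_min G \<tau>)"
proof -
  define a where "a = val_lfp (value_fun_min G \<tau>)"
  have a: "a \<in> valuations" "value_fun_min G \<tau> a = a"
    using lfp_value_fun_min[OF G] by (auto simp: a_def)
  have eq: "value_fun_min G \<tau>' a = value_fun G a"
    by (rule value_fun_sw_min[OF \<tau>]) (use \<tau>' in \<open>simp add: a_def\<close>)
  have "value_fun_min G \<tau>' a \<le> a"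
    using value_fun_le_value_fun_min[OF \<tau>, of a] a(2) eq by simp
  then have "val_lfp (value_fun_min G \<tau>') \<le> a"
    by (rule lfp_value_fun_min(3)[OF G a(1)])
  moreover have "value_fun_min G \<tau>' a \<noteq> a"
    unfolding eq by (rule sw_min_not_fixpoint[OF \<tau> a(2) _ \<tau>'(2)]) (use \<tau>'(1) in \<open>simp add: a_def\<close>)
  then have "val_lfp (value_fun_min G \<tau>') \<noteq> a"
    using lfp_value_fun_min(2)[OF G, of \<tau>'] by auto
  ultimately show ?thesis by (simp add: a_def less_le)
qed

text \<open>The old least fixpoint is a postfixpoint of the new function, which bounds the greatest
  fixpoint but not the least one. In a game that need not be stopping the comparison therefore uses
  the excess argument.\<close>

lemma lfp_sw_max_greater:
  fixes G :: "('v::finite) ssg"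
  assumes G: "simple_stochastic_game G" and \<sigma>: "\<sigma> \<in> max_strategies G"
    and \<sigma>': "\<sigma>' \<in> sw_max G \<sigma> (val_lfp (value_fun_max G \<sigma>))" "\<sigma>' \<noteq> \<sigma>"
  shows "val_lfp (value_fun_max G \<sigma>) < val_lfp (value_fun_max G \<sigma>')"
proof -
  define a where "a = val_lfp (value_fun_max G \<sigma>)"
  define b where "b = val_lfp (value_fun_max G \<sigma>')"
  have a: "a \<in> valuations" "value_fun_max G \<sigma> a = a"
    using lfp_value_fun_max[OF G] by (auto simp: a_def)
  have b: "b \<in> valuations" "value_fun_max G \<sigma>' b = b"
    using lfp_value_fun_max[OF G] by (auto simp: b_def)
  have sw: "\<sigma>' \<in> sw_max G \<sigma> a" using \<sigma>'(1) by (simp add: a_def)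
  have eq: "value_fun_max G \<sigma>' a = value_fun G a"
    by (rule value_fun_sw_max[OF G \<sigma> sw])
  have post: "a \<le> value_fun_max G \<sigma>' a"
    using value_fun_max_le_value_fun[OF G \<sigma>, of a] a(2) eq by simp
  have "a \<le> b"
  proof (rule ccontr)
    assume "\<not> a \<le> b"
    then obtain \<theta> v where \<theta>: "\<theta> > 0" "\<And>u. a u \<le> b u + \<theta>" "a v = b v + \<theta>"
      by (rule max_excess) blast
    define X where "X = {u. a u = b u + \<theta>}"
    \<comment> \<open>A node of \<open>X\<close> is not improved by the switch, as \<open>\<theta>\<close> is already the largest excess.\<close>
    have unswitched: "value_fun_max G \<sigma> b u = b u" if u: "u \<in> X" for u
    proof (cases "u \<in> max_nodes G")
      case True
      have "value_fun_max G \<sigma>' a u \<le> value_fun_max G \<sigma>' b u + \<theta>"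
        by (rule value_fun_max_nonexpansive[OF G \<theta>(2)]) (use \<theta>(1) in simp)
      then have "value_fun_max G \<sigma>' a u \<le> a u" using u b(2) by (simp add: X_def)
      moreover have "u \<notin> min_nodes G" by (rule max_node_not_min_node[OF G True])
      ultimately have "Max (a ` max_succ G u) \<le> a (\<sigma> u)"
        using eq True fun_cong[OF a(2), of u] by (simp add: value_fun_def value_fun_max_def)
      then have "\<sigma>' u = \<sigma> u" using sw True by (auto simp: sw_max_def)
      then show ?thesis using fun_cong[OF b(2), of u] True by (simp add: value_fun_max_def)
    next
      case False
      then show ?thesis using fun_cong[OF b(2), of u] by (simp add: value_fun_max_def)
    qed
    \<comment> \<open>The excess argument runs in the game restricted to the old \<sigma>. There
      \<open>a\<close> is a fixpoint, and \<open>b\<close>, though perhaps not a fixpoint, satisfies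
      the fixpoint equation at the nodes of \<open>X\<close>.\<close>
    note G' = simple_stochastic_game_restrict_max[OF G, of \<sigma>]
    note eq' = value_fun_restrict_max[OF G, of \<sigma>]
    obtain \<epsilon> where \<epsilon>: "\<epsilon> > 0"
      and dec': "\<And>u. a u = value_fun_max G \<sigma> b u + \<theta> \<Longrightarrow>
        value_fun_max G \<sigma> (\<lambda>u. a u \<ominus> on_set \<epsilon> X u) u \<le> a u - \<epsilon>"
      using value_fun_lower_max_excess[OF G' b(1) \<theta>(1,2)] unfolding eq' a(2) X_def by blast
    have dec: "value_fun_max G \<sigma> (\<lambda>u. a u \<ominus> on_set \<epsilon> X u) u \<le> a u - \<epsilon>" if "u \<in> X" for u
      by (rule dec') (use that unswitched[OF that] in \<open>simp add: X_def\<close>)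
    have "X \<noteq> {}" using \<theta>(3) by (auto simp: X_def)
    \<comment> \<open>The lowered valuation is a prefixpoint of
      \<open>value_fun_max G \<sigma>\<close> strictly below its least fixpoint
      \<open>a\<close>.\<close>
    from prefixpoint_lowered[OF G' a(1) _ \<epsilon> this, unfolded eq' a(2), OF order_refl dec]
    have "(\<lambda>v. a v - on_set \<epsilon> X v) < a" "a \<le> (\<lambda>v. a v - on_set \<epsilon> X v)"
      using lfp_value_fun_max(3)[OF G, of _ \<sigma>] by (simp_all add: a_def)
    then show False by simp
  qed
  moreover have "value_fun_max G \<sigma>' a \<noteq> a"
    unfolding eq by (rule sw_max_not_fixpoint[OF G \<sigma> a(2) sw \<sigma>'(2)])
  then have "a \<noteq> b" using b(2) by auto
  ultimately show ?thesis by (simp add: a_def b_def less_le)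
qed

text \<open>After the switch the restricted function agrees with \<open>value_fun G\<close> at
  \<open>a'\<close>, so \<open>a'\<close> is a prefixpoint of it as well.\<close>

lemma lfp_sw_min_lowered_less:
  fixes G :: "('v::finite) ssg"
  assumes G: "simple_stochastic_game G" and \<tau>: "\<tau> \<in> min_strategies G"
    and a': "a' \<in> valuations" "value_fun G a' \<le> a'" "a' < a" and \<tau>': "\<tau>' \<in> sw_min G \<tau> a'"
  shows "val_lfp (value_fun_min G \<tau>') < a"
proof -
  have "val_lfp (value_fun_min G \<tau>') \<le> a'"
    by (rule lfp_value_fun_min(3)[OF G a'(1)]) (simp add: value_fun_sw_min[OF \<tau> \<tau>'] a'(2))
  then show ?thesis using a'(3) by (rule le_less_trans)
qed

text \<open>Without an improving switch the result is a fixpoint of \<open>value_fun G\<close>. It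
  is also the least one, because \<open>value_fun_max G \<sigma>\<close> lies below
  \<open>value_fun G\<close>; from above the inequality is reversed, hence the extra check
  there.\<close>

lemma lfp_value_fun_max_eq_lfp:
  fixes G :: "('v::finite) ssg"
  assumes G: "simple_stochastic_game G" and \<sigma>: "\<sigma> \<in> max_strategies G"
    and sw: "\<sigma> \<in> sw_max G \<sigma> (val_lfp (value_fun_max G \<sigma>))"
  shows "val_lfp (value_fun_max G \<sigma>) = val_lfp (value_fun G)"
proof (rule antisym)
  note lfp = lfp_value_fun_max[OF G, where \<sigma>=\<sigma>]
  show "val_lfp (value_fun_max G \<sigma>) \<le> val_lfp (value_fun G)"
    by (rule lfp(3)[OF lfp_value_fun_valuations[OF G]])
      (metis value_fun_max_le_value_fun[OF G \<sigma>] lfp_value_fun_fixpoint[OF G])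
  show "val_lfp (value_fun G) \<le> val_lfp (value_fun_max G \<sigma>)"
    by (rule lfp_value_fun_lowerbound[OF G lfp(1)])
      (metis value_fun_sw_max[OF G \<sigma> sw] lfp(2) order_refl)
qed

subsection \<open>Termination and correctness\<close>

text \<open>Here \<open>m\<close> is the valuation attached to a strategy and \<open>R\<close> the
  direction of strict change, left abstract to cover descent and ascent alike.\<close>

lemma strategy_iteration_correct:
  assumes fin: "finite S" and init: "\<tau> \<in> S"
    and R: "transp R" "irreflp R"
    and iter: "\<And>\<tau> \<tau>'. \<tau> \<in> S \<Longrightarrow> step (Iterate \<tau>) (Iterate \<tau>') \<Longrightarrow> \<tau>' \<in> S \<and> R (m \<tau>') (m \<tau>)"
    and ret: "\<And>\<tau> b. \<tau> \<in> S \<Longrightarrow> step (Iterate \<tau>) (Return b) \<Longrightarrow> b = a"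
    and final: "\<And>b c. \<not> step (Return b) c"
    and progress: "\<And>\<tau>. \<tau> \<in> S \<Longrightarrow> \<exists>c. step (Iterate \<tau>) c"
  shows "terminates step (Iterate \<tau>) \<and> only_returns step (Iterate \<tau>) a"
proof
  show "terminates step (Iterate \<tau>)"
    unfolding terminates_def
  proof
    assume "\<exists>s. s (0::nat) = Iterate \<tau> \<and> (\<forall>i. step (s i) (s (Suc i)))"
    then obtain s where s: "s 0 = Iterate \<tau>" "\<And>i. step (s i) (s (Suc i))" by auto
    have "\<exists>t. s i = Iterate t" for i
      using s(2)[of i] final by (cases "s i") auto
    then obtain t where t: "\<And>i. s i = Iterate (t i)" by metis
    have step: "step (Iterate (t i)) (Iterate (t (Suc i)))" for i using s(2)[of i] by (simp add: t)
    have S: "t i \<in> S" for i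
    proof (induction i)
      case 0
      then show ?case using s(1) t[of 0] init by simp
    next
      case (Suc i)
      then show ?case using iter[OF _ step] by blast
    qed
    have dec: "R (m (t (Suc i))) (m (t i))" for i using iter[OF S step] by blast
    have "R (m (t (Suc (i + k)))) (m (t i))" for i k
    proof (induction k)
      case (Suc k)
      then show ?case using transpD[OF R(1) dec[of "Suc (i + k)"]] by simp
    qed (simp add: dec)
    \<comment> \<open>A repeated strategy would put \<open>m\<close> of it in relation
      \<open>R\<close> to itself.\<close>
    then have "t i \<noteq> t j" if "i < j" for i j
      using less_imp_Suc_add[OF that] irreflpD[OF R(2)] by metis
    then have "inj t" by (metis injI linorder_neqE_nat)
    moreover have "finite (range t)" using S by (intro finite_subset[OF _ fin]) auto
    ultimately show False using finite_imageD infinite_UNIV_nat by blast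
  qed
next
  \<comment> \<open>Together with \<open>progress\<close>, this invariant excludes configurations
    stuck before returning.\<close>
  have reach: "(\<exists>t\<in>S. c = Iterate t) \<or> c = Return a" if "step\<^sup>*\<^sup>* (Iterate \<tau>) c" for c
    using that
  proof (induction rule: rtranclp_induct)
    case base
    then show ?case using init by blast
  next
    case (step c d)
    then show ?case using iter ret final by (cases d) blast+
  qed
  then show "only_returns step (Iterate \<tau>) a"
    unfolding only_returns_def using progress by blast
qed

section \<open>The two algorithms as instances of the abstract iteration\<close>

lemma finite_strategies:
  fixes G :: "('v::finite) ssg"
  shows "finite (min_strategies G)" "finite (max_strategies G)"
  by (auto simp: min_strategies_def max_strategies_def intro: finite_PiE)

lemma lfp_unswitched_fixpoint:
  fixes G :: "('v::finite) ssg"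
  assumes G: "simple_stochastic_game G" and \<tau>: "\<tau> \<in> min_strategies G"
    and "\<tau> \<in> sw_min G \<tau> (val_lfp (value_fun_min G \<tau>))"
  shows "value_fun G (val_lfp (value_fun_min G \<tau>)) = val_lfp (value_fun_min G \<tau>)"
  using value_fun_sw_min[OF \<tau> assms(3)] lfp_value_fun_min(2)[OF G] by metis

lemma strategy_iteration_from_above:
  fixes G :: "('v::finite) ssg"
  assumes G: "simple_stochastic_game G" and "\<tau> \<in> min_strategies G"
  shows "terminates (above_step G) (Iterate \<tau>) \<and>
         only_returns (above_step G) (Iterate \<tau>) (val_lfp (value_fun G))"
proof (rule strategy_iteration_correct
    [where S="min_strategies G" and R="(<)" and m="\<lambda>\<tau>. val_lfp (value_fun_min G \<tau>)"])
  fix \<tau> \<tau>' assume \<tau>: "\<tau> \<in> min_strategies G" and step: "above_step G (Iterate \<tau>) (Iterate \<tau>')"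
  from step show "\<tau>' \<in> min_strategies G \<and>
      val_lfp (value_fun_min G \<tau>') < val_lfp (value_fun_min G \<tau>)"
  proof cases
    case (switch a)
    then show ?thesis using lfp_sw_min_less[OF G \<tau>] by (auto simp: sw_min_def)
  next
    case (decrease a \<tau>'' V' a')
    \<comment> \<open>In this case \<tau> is its own switch, so \<open>a\<close> is a fixpoint of
      \<open>value_fun G\<close>.\<close>
    note lfp = lfp_value_fun_min(1)[OF G, of \<tau>] lfp_unswitched_fixpoint[OF G \<tau>]
    have fixed: "value_fun G a = a" using decrease lfp(2) by simp
    have aval: "a \<in> valuations" using decrease lfp(1) by simp
    have "V' = gfp (approx (value_fun G) a)" using decrease pow_gfp_approx[OF G aval fixed] by simp
    from gfp_approx_lowered[OF G aval fixed this \<open>V' \<noteq> {}\<close>]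
    have "val_lfp (value_fun_min G \<tau>') < a"
      using decrease by (intro lfp_sw_min_lowered_less[OF G \<tau>, of a']) auto
    then show ?thesis using decrease by (auto simp: sw_min_def)
  qed
next
  fix \<tau> b assume \<tau>: "\<tau> \<in> min_strategies G" and step: "above_step G (Iterate \<tau>) (Return b)"
  from step show "b = val_lfp (value_fun G)"
  proof cases
    case (stop \<tau>' V')
    have fixed: "value_fun G b = b" using stop lfp_unswitched_fixpoint[OF G \<tau>] by simp
    have bval: "b \<in> valuations" using stop lfp_value_fun_min(1)[OF G, of \<tau>] by simp
    show ?thesis
      by (rule gfp_approx_empty_imp_lfp[OF G bval fixed])
        (use stop pow_gfp_approx[OF G bval fixed] in simp)
  qed
next
  fix \<tau> assume \<tau>: "\<tau> \<in> min_strategies G"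
  define a where "a = val_lfp (value_fun_min G \<tau>)"
  define V' where "V' = pow_gfp (support a) (approx (value_fun G) a)"
  define a' where "a' = (\<lambda>v. a v - on_set (iota_set (value_fun G) a V') V' v)"
  \<comment> \<open>Switches exist at both \<open>a\<close> and \<open>a'\<close>, so in each of the
    three cases below the matching transition is enabled.\<close>
  obtain \<tau>' where \<tau>': "\<tau>' \<in> sw_min G \<tau> a" using sw_min_nonempty[OF G \<tau>] by blast
  obtain \<tau>'' where \<tau>'': "\<tau>'' \<in> sw_min G \<tau> a'" using sw_min_nonempty[OF G \<tau>] by blast
  consider "\<tau>' \<noteq> \<tau>" | "\<tau>' = \<tau>" "V' = {}" | "\<tau>' = \<tau>" "V' \<noteq> {}" by blast
  then show "\<exists>c. above_step G (Iterate \<tau>) c"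
  proof cases
    case 1
    then show ?thesis using above_step.switch[OF a_def \<tau>'] by blast
  next
    case 2
    then show ?thesis using above_step.stop[OF a_def \<tau>' _ V'_def] by blast
  next
    case 3
    then show ?thesis using above_step.decrease[OF a_def \<tau>' _ V'_def _ a'_def \<tau>''] by blast
  qed
qed (use assms finite_strategies in \<open>auto elim: above_step.cases simp: irreflp_def\<close>)

lemma strategy_iteration_from_below:
  fixes G :: "('v::finite) ssg"
  assumes G: "simple_stochastic_game G" and "\<sigma> \<in> max_strategies G"
  shows "terminates (below_step G) (Iterate \<sigma>) \<and>
         only_returns (below_step G) (Iterate \<sigma>) (val_lfp (value_fun G))"
proof (rule strategy_iteration_correct
    [where S="max_strategies G" and R="(>)" and m="\<lambda>\<sigma>. val_lfp (value_fun_max G \<sigma>)"])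
  fix \<sigma> \<sigma>' assume \<sigma>: "\<sigma> \<in> max_strategies G" and step: "below_step G (Iterate \<sigma>) (Iterate \<sigma>')"
  from step show "\<sigma>' \<in> max_strategies G \<and>
      val_lfp (value_fun_max G \<sigma>') > val_lfp (value_fun_max G \<sigma>)"
    by cases (use lfp_sw_max_greater[OF G \<sigma>] in \<open>auto simp: sw_max_def\<close>)
next
  fix \<sigma> b assume \<sigma>: "\<sigma> \<in> max_strategies G" and step: "below_step G (Iterate \<sigma>) (Return b)"
  from step show "b = val_lfp (value_fun G)"
    by cases (use lfp_value_fun_max_eq_lfp[OF G \<sigma>] in \<open>auto simp: sw_max_def\<close>)
next
  fix \<sigma> assume "\<sigma> \<in> max_strategies G"
  then obtain \<sigma>' where "\<sigma>' \<in> sw_max G \<sigma> (val_lfp (value_fun_max G \<sigma>))"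
    using sw_max_nonempty[OF G] by blast
  then show "\<exists>c. below_step G (Iterate \<sigma>) c"
    using below_step.intros by (cases "\<sigma>' = \<sigma>") blast+
qed (use assms finite_strategies in \<open>auto elim: below_step.cases simp: irreflp_def\<close>)

theorem theorem7p6:
  fixes G :: "('v::finite) ssg"
  assumes "simple_stochastic_game G"
  shows "(\<forall>\<tau>\<in>min_strategies G.
            terminates (above_step G) (Iterate \<tau>) \<and>
            only_returns (above_step G) (Iterate \<tau>) (val_lfp (value_fun G))) \<and>
         (\<forall>\<sigma>\<in>max_strategies G.
            terminates (below_step G) (Iterate \<sigma>) \<and>
            only_returns (below_step G) (Iterate \<sigma>) (val_lfp (value_fun G)))"
  using strategy_iteration_from_above[OF assms] strategy_iteration_from_below[OF assms] by blast

end
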